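(* For a finite acyclic category $\mathcal{A}$, a core of $\mathcal{A}$ is uniquely determined up to isomorphism; that is, any two cores of $\mathcal{A}$ are isomorphic categories.
   Context: A category $\mathcal{A}$ is acyclic if (i) for objects $x\neq y$, $\mathcal{A}(y,x)\neq\emptyset$ implies $\mathcal{A}(x,y)=\emptyset$, and (ii) every endomorphism is an identity. It is finite if it has finitely many objects and morphisms. An object $x$ is a down beat object if there is a non-identity morphism $f\colon y\to x$ such that every non-identity morphism $g\colon z\to x$ factors as $g=f\circ\tilde g$ for a unique $\tilde g\colon z\to y$; up beat objects are down beat objects of $\mathcal{A}^{\mathrm{op}}$; a beat object is a down or up beat object. $\mathcal{A}\setminus x$ is the full subcategory on all objects other than $x$. If $x$ is a beat object of $\mathcal{A}$, there is an elementary strong collapse from $\mathcal{A}$ to $\mathcal{A}\setminus x$. For a full subcategory $\mathcal{B}$, there is a strong collapse from $\mathcal{A}$ to $\mathcal{B}$ if there is a (possibly empty) finite sequence of elementary strong collapses starting in $\mathcal{A}$ and ending in $\mathcal{B}$. An acyclic category is minimal if it has no beat object. A core of $\mathcal{A}$ is a full subcategory $\mathcal{B}$ which is minimal and such that there is a strong collapse from $\mathcal{A}$ to $\mathcal{B}$. *)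

theory Defs
  imports Main
begin

text \<open>
  Small categories with explicit carriers for objects and arrows. Outside the carriers the
  operations are unconstrained; \<open>Comp C g f\<close> is the composite \<open>g \<circ> f\<close>
  (first \<open>f\<close>, then \<open>g\<close>).
\<close>

record ('o, 'm) cat_data =
  Ob :: "'o set"
  Ar :: "'m set"
  Dom :: "'m \<Rightarrow> 'o"
  Cod :: "'m \<Rightarrow> 'o"
  Id :: "'o \<Rightarrow> 'm"
  Comp :: "'m \<Rightarrow> 'm \<Rightarrow> 'm"

definition hom :: "('o, 'm) cat_data \<Rightarrow> 'o \<Rightarrow> 'o \<Rightarrow> 'm set" where
  "hom C x y = {f \<in> Ar C. Dom C f = x \<and> Cod C f = y}"

locale category =
  fixes C :: "('o, 'm) cat_data"
  assumes Dom_in: "f \<in> Ar C \<Longrightarrow> Dom C f \<in> Ob C"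
    and Cod_in: "f \<in> Ar C \<Longrightarrow> Cod C f \<in> Ob C"
    and Id_in: "x \<in> Ob C \<Longrightarrow> Id C x \<in> hom C x x"
    and Comp_in: "\<lbrakk>f \<in> hom C x y; g \<in> hom C y z\<rbrakk> \<Longrightarrow> Comp C g f \<in> hom C x z"
    and Comp_Id_right: "f \<in> hom C x y \<Longrightarrow> Comp C f (Id C x) = f"
    and Comp_Id_left: "f \<in> hom C x y \<Longrightarrow> Comp C (Id C y) f = f"
    and Comp_assoc: "\<lbrakk>f \<in> hom C w x; g \<in> hom C x y; h \<in> hom C y z\<rbrakk>
      \<Longrightarrow> Comp C h (Comp C g f) = Comp C (Comp C h g) f"

locale acyclic_category = category +
  assumes no_return: "\<lbrakk>x \<in> Ob C; y \<in> Ob C; x \<noteq> y; hom C y x \<noteq> {}\<rbrakk> \<Longrightarrow> hom C x y = {}"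
    and endo_Id: "\<lbrakk>x \<in> Ob C; f \<in> hom C x x\<rbrakk> \<Longrightarrow> f = Id C x"

definition finite_category :: "('o, 'm) cat_data \<Rightarrow> bool" where
  "finite_category C \<longleftrightarrow> finite (Ob C) \<and> finite (Ar C)"

definition opposite :: "('o, 'm) cat_data \<Rightarrow> ('o, 'm) cat_data" where
  "opposite C = C\<lparr>Dom := Cod C, Cod := Dom C, Comp := \<lambda>g f. Comp C f g\<rparr>"

definition full_subcategory :: "('o, 'm) cat_data \<Rightarrow> 'o set \<Rightarrow> ('o, 'm) cat_data" where
  "full_subcategory C S = C\<lparr>Ob := S, Ar := {f \<in> Ar C. Dom C f \<in> S \<and> Cod C f \<in> S}\<rparr>"

definition delete_object :: "('o, 'm) cat_data \<Rightarrow> 'o \<Rightarrow> ('o, 'm) cat_data" where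
  "delete_object C x = full_subcategory C (Ob C - {x})"

definition nonidentity_hom :: "('o, 'm) cat_data \<Rightarrow> 'o \<Rightarrow> 'o \<Rightarrow> 'm set" where
  "nonidentity_hom C x y = hom C x y - Id C ` Ob C"

definition down_beat :: "('o, 'm) cat_data \<Rightarrow> 'o \<Rightarrow> bool" where
  "down_beat C x \<longleftrightarrow> x \<in> Ob C \<and>
     (\<exists>y\<in>Ob C. \<exists>f\<in>nonidentity_hom C y x.
        \<forall>z\<in>Ob C. \<forall>g\<in>nonidentity_hom C z x. \<exists>!h. h \<in> hom C z y \<and> g = Comp C f h)"

definition up_beat :: "('o, 'm) cat_data \<Rightarrow> 'o \<Rightarrow> bool" where
  "up_beat C x \<longleftrightarrow> down_beat (opposite C) x"

definition beat_object :: "('o, 'm) cat_data \<Rightarrow> 'o \<Rightarrow> bool" where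
  "beat_object C x \<longleftrightarrow> down_beat C x \<or> up_beat C x"

definition elementary_strong_collapse ::
    "('o, 'm) cat_data \<Rightarrow> ('o, 'm) cat_data \<Rightarrow> bool" where
  "elementary_strong_collapse C D \<longleftrightarrow> (\<exists>x. beat_object C x \<and> D = delete_object C x)"

definition strong_collapse :: "('o, 'm) cat_data \<Rightarrow> ('o, 'm) cat_data \<Rightarrow> bool" where
  "strong_collapse = elementary_strong_collapse\<^sup>*\<^sup>*"

definition minimal_category :: "('o, 'm) cat_data \<Rightarrow> bool" where
  "minimal_category C \<longleftrightarrow> acyclic_category C \<and> (\<nexists>x. beat_object C x)"

definition is_core :: "('o, 'm) cat_data \<Rightarrow> ('o, 'm) cat_data \<Rightarrow> bool" where
  "is_core C B \<longleftrightarrow> (\<exists>S\<subseteq>Ob C. B = full_subcategory C S) \<and>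
     minimal_category B \<and> strong_collapse C B"

locale cat_functor = source: category C + target: category D
  for C :: "('o, 'm) cat_data" and D :: "('p, 'n) cat_data" +
  fixes Fo :: "'o \<Rightarrow> 'p" and Fa :: "'m \<Rightarrow> 'n"
  assumes Fo_in: "x \<in> Ob C \<Longrightarrow> Fo x \<in> Ob D"
    and Fa_in: "f \<in> hom C x y \<Longrightarrow> Fa f \<in> hom D (Fo x) (Fo y)"
    and Fa_Id: "x \<in> Ob C \<Longrightarrow> Fa (Id C x) = Id D (Fo x)"
    and Fa_Comp: "\<lbrakk>f \<in> hom C x y; g \<in> hom C y z\<rbrakk> \<Longrightarrow> Fa (Comp C g f) = Comp D (Fa g) (Fa f)"

definition isomorphic_categories :: "('o, 'm) cat_data \<Rightarrow> ('p, 'n) cat_data \<Rightarrow> bool" where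
  "isomorphic_categories C D \<longleftrightarrow>
     (\<exists>Fo Fa Go Ga. cat_functor C D Fo Fa \<and> cat_functor D C Go Ga \<and>
        (\<forall>x\<in>Ob C. Go (Fo x) = x) \<and> (\<forall>f\<in>Ar C. Ga (Fa f) = f) \<and>
        (\<forall>y\<in>Ob D. Fo (Go y) = y) \<and> (\<forall>g\<in>Ar D. Fa (Ga g) = g))"

lemma hom_opposite [simp]: "hom (opposite C) x y = hom C y x"
  by (auto simp: hom_def opposite_def)

lemma hom_full_subcategory:
  "hom (full_subcategory C S) x y = (if x \<in> S \<and> y \<in> S then hom C x y else {})"
  by (auto simp: hom_def full_subcategory_def)

lemma category_opposite:
  assumes "category C"
  shows "category (opposite C)"
proof -
  interpret category C by fact
  have sel: "Ob (opposite C) = Ob C" "Ar (opposite C) = Ar C" "Dom (opposite C) = Cod C"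
    "Cod (opposite C) = Dom C" "Id (opposite C) = Id C"
    "Comp (opposite C) = (\<lambda>g f. Comp C f g)"
    by (simp_all add: opposite_def)
  show ?thesis
    by (rule category.intro)
      (simp_all only: sel hom_opposite Dom_in Cod_in Id_in Comp_in Comp_Id_left Comp_Id_right,
        rule Comp_assoc[symmetric])
qed

lemma acyclic_category_full_subcategory:
  assumes "acyclic_category C" and "S \<subseteq> Ob C"
  shows "acyclic_category (full_subcategory C S)"
proof -
  interpret acyclic_category C by fact
  have sel: "Ob (full_subcategory C S) = S" "Dom (full_subcategory C S) = Dom C"
    "Cod (full_subcategory C S) = Cod C" "Id (full_subcategory C S) = Id C"
    "Comp (full_subcategory C S) = Comp C"
    "Ar (full_subcategory C S) = {f \<in> Ar C. Dom C f \<in> S \<and> Cod C f \<in> S}"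
    by (simp_all add: full_subcategory_def)
  have hom: "f \<in> hom C x y" "x \<in> S" "y \<in> S"
    if "f \<in> hom (full_subcategory C S) x y" for f x y
    using that by (auto simp: hom_full_subcategory split: if_splits)
  show ?thesis
  proof
    fix x y assume "x \<in> Ob (full_subcategory C S)" "y \<in> Ob (full_subcategory C S)" "x \<noteq> y"
      and "hom (full_subcategory C S) y x \<noteq> {}"
    then show "hom (full_subcategory C S) x y = {}"
      using no_return[of x y] assms(2) by (auto simp: sel(1) hom_full_subcategory)
  next
    fix w x y z f g h
    assume "f \<in> hom (full_subcategory C S) w x" "g \<in> hom (full_subcategory C S) x y"
      "h \<in> hom (full_subcategory C S) y z"
    then show "Comp (full_subcategory C S) h (Comp (full_subcategory C S) g f) =
        Comp (full_subcategory C S) (Comp (full_subcategory C S) h g) f"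
      unfolding sel by (meson Comp_assoc hom(1))
  next
    fix x y z f g
    assume "f \<in> hom (full_subcategory C S) x y" "g \<in> hom (full_subcategory C S) y z"
    then show "Comp (full_subcategory C S) g f \<in> hom (full_subcategory C S) x z"
      using Comp_in hom by (metis hom_full_subcategory sel(5))
  qed (use assms(2) Id_in in \<open>auto simp: sel hom_full_subcategory Comp_Id_left Comp_Id_right endo_Id
      split: if_splits\<close>)
qed

end

theory Submission
  imports Defs
begin

text \<open>
  Elementary strong collapses are locally confluent up to isomorphism. If \<open>x \<noteq> y\<close> are beat
  objects of \<open>C\<close>, then usually each of them is still a beat object after the other one is deleted.
  The only exception is a pair where \<open>x\<close> is down beat and \<open>y\<close> is up beat through one and the same
  arrow \<open>y \<rightarrow> x\<close>; there, composition with this arrow identifies the arrows into (out of) \<open>y\<close> with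
  those into (out of) \<open>x\<close>, so \<open>C \<setminus> x\<close> and \<open>C \<setminus> y\<close> are isomorphic. Uniqueness of the core follows by
  induction on the number of objects, as in Newman's lemma.
\<close>

section \<open>Isomorphisms\<close>

lemma bij_betw_eq: "bij_betw f X Y \<Longrightarrow> (\<And>a. a \<in> X \<Longrightarrow> f a = g a) \<Longrightarrow> bij_betw g X Y"
  using bij_betw_cong by blast

section \<open>Opposite categories and deletion of an object\<close>

lemma opposite_simps [simp]:
  "Ob (opposite C) = Ob C" "Id (opposite C) = Id C" "Comp (opposite C) g f = Comp C f g"
  by (simp_all add: opposite_def)

lemma acyclic_category_opposite:
  assumes "acyclic_category C"
  shows "acyclic_category (opposite C)"
proof -
  interpret acyclic_category C by fact
  show ?thesis
    using category_opposite[OF category_axioms] no_return endo_Id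
    by (auto simp: acyclic_category_def acyclic_category_axioms_def)
qed

lemma full_subcategory_simps [simp]:
  "Ob (full_subcategory C S) = S" "Id (full_subcategory C S) = Id C"
  "Comp (full_subcategory C S) = Comp C"
  by (simp_all add: full_subcategory_def)

lemma Ob_delete_object [simp]: "Ob (delete_object C x) = Ob C - {x}"
  and Id_delete_object [simp]: "Id (delete_object C x) = Id C"
  and Comp_delete_object [simp]: "Comp (delete_object C x) = Comp C"
  by (simp_all add: delete_object_def)

lemma hom_delete_object [simp]:
  "z \<in> Ob C \<Longrightarrow> w \<in> Ob C \<Longrightarrow> z \<noteq> x \<Longrightarrow> w \<noteq> x \<Longrightarrow> hom (delete_object C x) z w = hom C z w"
  by (simp add: delete_object_def hom_full_subcategory)

lemma opposite_delete_object: "opposite (delete_object C x) = delete_object (opposite C) x"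
  by (cases C) (auto simp: delete_object_def full_subcategory_def opposite_def)

text \<open>Equality of the two records, not merely an isomorphism. This lets two deletions made in
  either order close a confluence square with one and the same corner.\<close>

lemma delete_object_commute:
  "delete_object (delete_object C x) y = delete_object (delete_object C y) x"
  by (auto simp: delete_object_def full_subcategory_def
      intro!: arg_cong2[where f = "\<lambda>S T. C\<lparr>Ob := S, Ar := T\<rparr>"])

lemma acyclic_category_delete_object:
  "acyclic_category C \<Longrightarrow> acyclic_category (delete_object C x)"
  unfolding delete_object_def by (rule acyclic_category_full_subcategory) auto

lemma (in category) hom_Ob: "f \<in> hom C x y \<Longrightarrow> x \<in> Ob C \<and> y \<in> Ob C"
  using Dom_in Cod_in by (auto simp: hom_def)

lemma (in category) Ar_hom: "f \<in> Ar C \<Longrightarrow> f \<in> hom C (Dom C f) (Cod C f)"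
  by (simp add: hom_def)

text \<open>Bijectivity on objects and on each hom-set takes the place of an inverse functor. It can
  be checked without constructing the inverse, and it passes readily to composites, opposites and
  deletions of an object.\<close>

locale iso_functor = cat_functor C D Fo Fa
  for C :: "('o, 'm) cat_data" and D :: "('p, 'n) cat_data" and Fo Fa +
  assumes bij_Ob: "bij_betw Fo (Ob C) (Ob D)"
    and bij_hom: "\<lbrakk>x \<in> Ob C; y \<in> Ob C\<rbrakk> \<Longrightarrow> bij_betw Fa (hom C x y) (hom D (Fo x) (Fo y))"

lemma (in iso_functor) isomorphic: "isomorphic_categories C D"
proof -
  define Go where "Go = inv_into (Ob C) Fo"
  \<comment> \<open>Bijectivity of \<open>Fa\<close> is given hom-set by hom-set, so an arrow is
    inverted inside the hom-set between the preimages of its endpoints.\<close>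
  define Ga where "Ga g = inv_into (hom C (Go (Dom D g)) (Go (Cod D g))) Fa g" for g
  have Go_in: "Go y \<in> Ob C" and Fo_Go: "Fo (Go y) = y" if "y \<in> Ob D" for y
    using bij_betw_inv_into_right[OF bij_Ob that] bij_betwE[OF bij_betw_inv_into[OF bij_Ob]] that
    by (auto simp: Go_def)
  have Go_Fo: "Go (Fo x) = x" if "x \<in> Ob C" for x
    using bij_betw_inv_into_left[OF bij_Ob that] by (simp add: Go_def)
  have Ga: "Ga g \<in> hom C (Go x) (Go y)" "Fa (Ga g) = g" if g: "g \<in> hom D x y" for g x y
  proof -
    have xy: "x \<in> Ob D" "y \<in> Ob D" and [simp]: "Dom D g = x" "Cod D g = y"
      using target.hom_Ob[OF g] g by (auto simp: hom_def)
    have b: "bij_betw Fa (hom C (Go x) (Go y)) (hom D x y)"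
      using bij_hom[of "Go x" "Go y"] xy by (simp add: Go_in Fo_Go)
    show "Ga g \<in> hom C (Go x) (Go y)" "Fa (Ga g) = g"
      using bij_betw_inv_into_right[OF b g] bij_betwE[OF bij_betw_inv_into[OF b]] g
      by (auto simp: Ga_def)
  qed
  have inj: "f = f'" if "f \<in> hom C x y" "f' \<in> hom C x y" "Fa f = Fa f'" for f f' x y
    using bij_hom[of x y] source.hom_Ob[OF that(1)] that
    by (auto simp: bij_betw_def inj_on_def)
  have Ga_Fa: "Ga (Fa f) = f" if f: "f \<in> hom C x y" for f x y
  proof (rule inj[OF _ f])
    show "Ga (Fa f) \<in> hom C x y"
      using Ga(1)[OF Fa_in[OF f]] source.hom_Ob[OF f] by (simp add: Go_Fo)
    show "Fa (Ga (Fa f)) = Fa f" using Ga(2)[OF Fa_in[OF f]] .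
  qed
  have "cat_functor D C Go Ga"
  proof
    fix y assume y: "y \<in> Ob D"
    show "Go y \<in> Ob C" using y by (rule Go_in)
    show "Ga (Id D y) = Id C (Go y)"
      using Ga_Fa[OF source.Id_in[OF Go_in[OF y]]] Fa_Id[OF Go_in[OF y]] Fo_Go[OF y] by simp
  next
    fix f x y assume "f \<in> hom D x y"
    then show "Ga f \<in> hom C (Go x) (Go y)" by (rule Ga)
  next
    \<comment> \<open>Functoriality of the inverse: apply \<open>Fa\<close> to the composite of the
      preimages, then cancel it with \<open>Ga_Fa\<close>.\<close>
    fix f g x y z assume f: "f \<in> hom D x y" and g: "g \<in> hom D y z"
    have "Fa (Comp C (Ga g) (Ga f)) = Comp D g f"
      using Fa_Comp[OF Ga(1)[OF f] Ga(1)[OF g]] Ga(2)[OF f] Ga(2)[OF g] by simp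
    then show "Ga (Comp D g f) = Comp C (Ga g) (Ga f)"
      using Ga_Fa[OF source.Comp_in[OF Ga(1)[OF f] Ga(1)[OF g]]] by simp
  qed
  then show ?thesis
    unfolding isomorphic_categories_def
    using cat_functor_axioms Go_Fo Fo_Go Ga_Fa[OF source.Ar_hom] Ga(2)[OF target.Ar_hom]
    by blast
qed

text \<open>On each hom-set the arrow part of the inverse functor is a two-sided inverse of
  \<open>Fa\<close>; it lands in the right hom-set because \<open>Go\<close> undoes
  \<open>Fo\<close> on the endpoints.\<close>

lemma isomorphic_categories_iso_functor:
  assumes "isomorphic_categories C D"
  obtains Fo Fa where "iso_functor C D Fo Fa"
proof -
  obtain Fo Fa Go Ga where F: "cat_functor C D Fo Fa" and G: "cat_functor D C Go Ga"
    and GF: "\<And>x. x \<in> Ob C \<Longrightarrow> Go (Fo x) = x" "\<And>f. f \<in> Ar C \<Longrightarrow> Ga (Fa f) = f"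
    and FG: "\<And>y. y \<in> Ob D \<Longrightarrow> Fo (Go y) = y" "\<And>g. g \<in> Ar D \<Longrightarrow> Fa (Ga g) = g"
    using assms unfolding isomorphic_categories_def by blast
  interpret F: cat_functor C D Fo Fa by fact
  interpret G: cat_functor D C Go Ga by fact
  have Ar: "f \<in> Ar E" if "f \<in> hom E x y" for E :: "('x, 'y) cat_data" and f x y
    using that by (simp add: hom_def)
  have "iso_functor C D Fo Fa"
  proof
    show "bij_betw Fo (Ob C) (Ob D)"
      by (rule bij_betw_byWitness[where f' = Go]) (use GF FG F.Fo_in G.Fo_in in auto)
  next
    fix x y assume xy: "x \<in> Ob C" "y \<in> Ob C"
    show "bij_betw Fa (hom C x y) (hom D (Fo x) (Fo y))"
      by (rule bij_betw_byWitness[where f' = Ga])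
        (use GF FG F.Fa_in G.Fa_in[of _ "Fo x" "Fo y"] xy in \<open>auto dest: Ar\<close>)
  qed
  then show thesis by (rule that)
qed

lemma isomorphic_categories_refl:
  assumes "category C" shows "isomorphic_categories C C"
proof -
  interpret category C by fact
  have "cat_functor C C id id" by unfold_locales auto
  then show ?thesis unfolding isomorphic_categories_def by (metis id_apply)
qed

lemma isomorphic_categories_sym:
  "isomorphic_categories C D \<Longrightarrow> isomorphic_categories D C"
  unfolding isomorphic_categories_def by blast

lemma isomorphic_categories_trans:
  assumes "isomorphic_categories C D" and "isomorphic_categories D E"
  shows "isomorphic_categories C E"
proof -
  obtain Fo Fa where "iso_functor C D Fo Fa"
    using isomorphic_categories_iso_functor[OF assms(1)] .
  then interpret F: iso_functor C D Fo Fa .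
  obtain Go Ga where "iso_functor D E Go Ga"
    using isomorphic_categories_iso_functor[OF assms(2)] .
  then interpret G: iso_functor D E Go Ga .
  have "iso_functor C E (Go \<circ> Fo) (Ga \<circ> Fa)"
  proof
    show "bij_betw (Go \<circ> Fo) (Ob C) (Ob E)"
      using F.bij_Ob G.bij_Ob by (rule bij_betw_trans)
  next
    fix x y assume "x \<in> Ob C" "y \<in> Ob C"
    then show "bij_betw (Ga \<circ> Fa) (hom C x y) (hom E ((Go \<circ> Fo) x) ((Go \<circ> Fo) y))"
      using bij_betw_trans[OF F.bij_hom G.bij_hom] F.Fo_in by simp
  next
    fix x y z f g assume "f \<in> hom C x y" "g \<in> hom C y z"
    then show "(Ga \<circ> Fa) (Comp C g f) = Comp E ((Ga \<circ> Fa) g) ((Ga \<circ> Fa) f)"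
      using F.Fa_Comp G.Fa_Comp[OF F.Fa_in F.Fa_in] by simp
  qed (simp_all add: F.Fo_in G.Fo_in F.Fa_in G.Fa_in F.Fa_Id G.Fa_Id)
  then show ?thesis by (rule iso_functor.isomorphic)
qed

section \<open>Isomorphisms under duality and deletion\<close>

lemma iso_functor_opposite:
  assumes "iso_functor C D Fo Fa"
  shows "iso_functor (opposite C) (opposite D) Fo Fa"
proof -
  interpret iso_functor C D Fo Fa by fact
  interpret C': category "opposite C" by (rule category_opposite) unfold_locales
  interpret D': category "opposite D" by (rule category_opposite) unfold_locales
  show ?thesis
    by unfold_locales (simp_all add: Fo_in Fa_in Fa_Id Fa_Comp bij_Ob bij_hom)
qed

text \<open>Stated without acyclicity because \<open>cat_functor\<close> asks only for
  \<open>category\<close> on both sides.\<close>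

lemma category_delete_object:
  assumes "category C" shows "category (delete_object C x)"
proof -
  interpret category C by fact
  have hom: "f \<in> hom (delete_object C x) z w \<longleftrightarrow> f \<in> hom C z w \<and> z \<noteq> x \<and> w \<noteq> x" for f z w
    using hom_Ob by (auto simp: delete_object_def hom_full_subcategory)
  have sel: "Dom (delete_object C x) = Dom C" "Cod (delete_object C x) = Cod C"
    by (simp_all add: delete_object_def full_subcategory_def)
  show ?thesis
  proof
    fix f assume "f \<in> Ar (delete_object C x)"
    then show "Dom (delete_object C x) f \<in> Ob (delete_object C x)"
      "Cod (delete_object C x) f \<in> Ob (delete_object C x)"
      by (auto simp: delete_object_def full_subcategory_def)
  qed (auto simp: hom Id_in Comp_in Comp_Id_left Comp_Id_right intro: Comp_assoc)
qed

text \<open>Injectivity of \<open>Fo\<close> keeps the image of every remaining object away from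
  \<open>Fo x\<close>, so the functor restricts; no hom-set between remaining objects
  changes.\<close>

lemma iso_functor_delete_object:
  assumes "iso_functor C D Fo Fa" and x: "x \<in> Ob C"
  shows "iso_functor (delete_object C x) (delete_object D (Fo x)) Fo Fa"
proof -
  interpret iso_functor C D Fo Fa by fact
  interpret C': category "delete_object C x" by (rule category_delete_object) unfold_locales
  interpret D': category "delete_object D (Fo x)" by (rule category_delete_object) unfold_locales
  have ne: "Fo z \<noteq> Fo x" if "z \<in> Ob C" "z \<noteq> x" for z
    using bij_Ob that x by (auto simp: bij_betw_def inj_on_def)
  have hom: "f \<in> hom (delete_object C x) z w \<longleftrightarrow> f \<in> hom C z w \<and> z \<noteq> x \<and> w \<noteq> x" for f z w
    using source.hom_Ob by (auto simp: delete_object_def hom_full_subcategory)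
  show ?thesis
  proof
    show "bij_betw Fo (Ob (delete_object C x)) (Ob (delete_object D (Fo x)))"
      using bij_betw_DiffI[OF bij_Ob, of "{x}" "{Fo x}"] x Fo_in by (auto simp: bij_betw_def)
  next
    fix z w assume "z \<in> Ob (delete_object C x)" "w \<in> Ob (delete_object C x)"
    then show "bij_betw Fa (hom (delete_object C x) z w) (hom (delete_object D (Fo x)) (Fo z) (Fo w))"
      using bij_hom ne Fo_in by simp
  next
    fix f z w assume f: "f \<in> hom (delete_object C x) z w"
    then show "Fa f \<in> hom (delete_object D (Fo x)) (Fo z) (Fo w)"
      using ne Fo_in Fa_in source.hom_Ob[of f z w] by (simp add: hom)
  next
    fix f g z w v assume "f \<in> hom (delete_object C x) z w" "g \<in> hom (delete_object C x) w v"
    then show "Fa (Comp (delete_object C x) g f) = Comp (delete_object D (Fo x)) (Fa g) (Fa f)"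
      using Fa_Comp[of f z w g v] by (simp add: hom)
  qed (use ne Fo_in Fa_Id in auto)
qed

section \<open>Beat objects\<close>

text \<open>Down beat objects with their witnesses exposed. Unique factorization becomes bijectivity
  of postcomposition with \<open>f\<close>, so that factorizations can be composed and transported
  as bijections. Non-identity arrows into \<open>x\<close> are replaced by all arrows from objects
  other than \<open>x\<close>.\<close>

definition down_beat_arrow :: "('o, 'm) cat_data \<Rightarrow> 'm \<Rightarrow> 'o \<Rightarrow> 'o \<Rightarrow> bool" where
  "down_beat_arrow C f y x \<longleftrightarrow> x \<in> Ob C \<and> y \<in> Ob C \<and> y \<noteq> x \<and> f \<in> hom C y x \<and>
     (\<forall>z\<in>Ob C - {x}. bij_betw (Comp C f) (hom C z y) (hom C z x))"

text \<open>Acyclicity makes the non-identity arrows exactly those between distinct objects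
  (\<open>nonid\<close>), and unique factorization of every arrow of a hom-set is bijectivity of
  postcomposition (\<open>bij\<close>).\<close>

lemma down_beat_iff_arrow:
  assumes "acyclic_category C"
  shows "down_beat C x \<longleftrightarrow> (\<exists>y f. down_beat_arrow C f y x)"
proof -
  interpret acyclic_category C by fact
  have nonid: "nonidentity_hom C z w = (if z = w then {} else hom C z w)"
    if "z \<in> Ob C" "w \<in> Ob C" for z w
  proof -
    have "z = w" if "Id C v \<in> hom C z w" "v \<in> Ob C" for v
      using that Id_in[of v] by (auto simp: hom_def)
    then show ?thesis
      using that endo_Id[of z] by (cases "z = w") (auto simp: nonidentity_hom_def)
  qed
  have bij: "bij_betw (Comp C f) (hom C z y) (hom C z x) \<longleftrightarrow>
      (\<forall>g\<in>hom C z x. \<exists>!h. h \<in> hom C z y \<and> g = Comp C f h)" if f: "f \<in> hom C y x" for f y z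
  proof
    assume b: "bij_betw (Comp C f) (hom C z y) (hom C z x)"
    show "\<forall>g\<in>hom C z x. \<exists>!h. h \<in> hom C z y \<and> g = Comp C f h"
    proof
      fix g assume "g \<in> hom C z x"
      then obtain h where "h \<in> hom C z y" "g = Comp C f h"
        using b by (auto simp: bij_betw_def)
      then show "\<exists>!h. h \<in> hom C z y \<and> g = Comp C f h"
        using b by (intro ex1I[of _ h]) (auto simp: bij_betw_def dest: inj_onD)
    qed
  next
    assume u: "\<forall>g\<in>hom C z x. \<exists>!h. h \<in> hom C z y \<and> g = Comp C f h"
    have into: "Comp C f h \<in> hom C z x" if "h \<in> hom C z y" for h
      using Comp_in[OF that f] .
    have "inj_on (Comp C f) (hom C z y)"
      using u into by (intro inj_onI) blast
    moreover have "Comp C f ` hom C z y = hom C z x"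
      using u into by blast
    ultimately show "bij_betw (Comp C f) (hom C z y) (hom C z x)"
      by (simp add: bij_betw_def)
  qed
  show ?thesis
  proof
    assume "down_beat C x"
    then obtain y f where x: "x \<in> Ob C" and y: "y \<in> Ob C" and f: "f \<in> nonidentity_hom C y x"
      and u: "\<forall>z\<in>Ob C. \<forall>g\<in>nonidentity_hom C z x. \<exists>!h. h \<in> hom C z y \<and> g = Comp C f h"
      unfolding down_beat_def by (elim conjE bexE)
    have yx: "y \<noteq> x" and f': "f \<in> hom C y x"
      using f nonid[OF y x] by (auto split: if_splits)
    have "bij_betw (Comp C f) (hom C z y) (hom C z x)" if z: "z \<in> Ob C - {x}" for z
      unfolding bij[OF f'] using bspec[OF u, of z] nonid[of z x] x z by simp
    then show "\<exists>y f. down_beat_arrow C f y x"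
      using x y yx f' unfolding down_beat_arrow_def by blast
  next
    assume "\<exists>y f. down_beat_arrow C f y x"
    then obtain y f where x: "x \<in> Ob C" and y: "y \<in> Ob C" "y \<noteq> x" and f: "f \<in> hom C y x"
      and b: "\<And>z. z \<in> Ob C - {x} \<Longrightarrow> bij_betw (Comp C f) (hom C z y) (hom C z x)"
      unfolding down_beat_arrow_def by blast
    have "f \<in> nonidentity_hom C y x"
      using f nonid[OF y(1) x] y(2) by simp
    moreover have "\<exists>!h. h \<in> hom C z y \<and> g = Comp C f h"
      if z: "z \<in> Ob C" and g: "g \<in> nonidentity_hom C z x" for z g
    proof -
      have "z \<noteq> x" and "g \<in> hom C z x"
        using g nonid[OF z x] by (auto split: if_splits)
      then show ?thesis using b[of z] z unfolding bij[OF f] by simp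
    qed
    ultimately show "down_beat C x"
      unfolding down_beat_def using x y(1) by (intro conjI bexI[of _ y] bexI[of _ f] ballI)
  qed
qed

lemma up_beat_iff_arrow:
  assumes "acyclic_category C"
  shows "up_beat C x \<longleftrightarrow> (\<exists>y f. down_beat_arrow (opposite C) f y x)"
  using down_beat_iff_arrow[OF acyclic_category_opposite[OF assms]] by (simp add: up_beat_def)

lemma beat_object_Ob: "beat_object C x \<Longrightarrow> x \<in> Ob C"
  by (auto simp: beat_object_def up_beat_def down_beat_def)

lemma opposite_opposite [simp]: "opposite (opposite C) = C"
  by (simp add: opposite_def)

text \<open>Functoriality says that \<open>Fa\<close> intertwines postcomposition with
  \<open>f\<close> and postcomposition with \<open>Fa f\<close>. Since \<open>Fa\<close> is
  bijective on hom-sets, one of these maps is bijective when the other is.\<close>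

lemma down_beat_arrow_iso:
  assumes "iso_functor C D Fo Fa" and "down_beat_arrow C f y x"
  shows "down_beat_arrow D (Fa f) (Fo y) (Fo x)"
proof -
  interpret iso_functor C D Fo Fa by fact
  have x: "x \<in> Ob C" and y: "y \<in> Ob C" and yx: "y \<noteq> x" and f: "f \<in> hom C y x"
    and bij: "\<And>z. z \<in> Ob C - {x} \<Longrightarrow> bij_betw (Comp C f) (hom C z y) (hom C z x)"
    using assms(2) by (auto simp: down_beat_arrow_def)
  have "bij_betw (Comp D (Fa f)) (hom D z' (Fo y)) (hom D z' (Fo x))"
    if z': "z' \<in> Ob D - {Fo x}" for z'
  proof -
    obtain z where z: "z \<in> Ob C - {x}" "z' = Fo z"
      using z' bij_Ob by (auto simp: bij_betw_def)
    have "bij_betw (Fa \<circ> Comp C f) (hom C z y) (hom D (Fo z) (Fo x))"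
      using bij_betw_trans[OF bij[OF z(1)] bij_hom] z x by simp
    moreover have "(Fa \<circ> Comp C f) h = (Comp D (Fa f) \<circ> Fa) h" if "h \<in> hom C z y" for h
      using Fa_Comp[OF that f] by simp
    ultimately have "bij_betw (Comp D (Fa f) \<circ> Fa) (hom C z y) (hom D (Fo z) (Fo x))"
      by (rule bij_betw_eq)
    moreover have b: "bij_betw Fa (hom C z y) (hom D (Fo z) (Fo y))"
      using bij_hom z y by simp
    ultimately show ?thesis
      unfolding z(2) using bij_betw_comp_iff[OF b] by blast
  qed
  moreover have "Fo y \<noteq> Fo x"
    using bij_Ob x y yx by (auto simp: bij_betw_def inj_on_def)
  ultimately show ?thesis
    using x y f Fo_in Fa_in by (auto simp: down_beat_arrow_def)
qed

lemma beat_object_iso: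
  assumes F: "iso_functor C D Fo Fa" and "acyclic_category C" "acyclic_category D"
    and "beat_object C x"
  shows "beat_object D (Fo x)"
  using assms(4) down_beat_arrow_iso[OF F] down_beat_arrow_iso[OF iso_functor_opposite[OF F]]
  unfolding beat_object_def down_beat_iff_arrow[OF assms(2)] down_beat_iff_arrow[OF assms(3)]
    up_beat_iff_arrow[OF assms(2)] up_beat_iff_arrow[OF assms(3)]
  by blast

section \<open>Beat objects after deletion of another object\<close>

lemma down_beat_arrow_delete_other:
  assumes "down_beat_arrow C f y x" "z \<noteq> x" "z \<noteq> y"
  shows "down_beat_arrow (delete_object C z) f y x"
  using assms by (auto simp: down_beat_arrow_def)

text \<open>When the source \<open>y\<close> of the beat arrow is itself down beat, the composite
  arrow from \<open>z\<close> replaces \<open>f\<close>: postcomposition with it is the composite of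
  two bijections.\<close>

lemma down_beat_arrow_delete_source:
  assumes "acyclic_category C" and f: "down_beat_arrow C f y x" and g: "down_beat_arrow C g z y"
  shows "down_beat_arrow (delete_object C y) (Comp C f g) z x"
proof -
  interpret acyclic_category C by fact
  have *: "x \<in> Ob C" "y \<in> Ob C" "z \<in> Ob C" "y \<noteq> x" "z \<noteq> y" "f \<in> hom C y x" "g \<in> hom C z y"
    using f g by (auto simp: down_beat_arrow_def)
  \<comment> \<open>If \<open>z\<close> were \<open>x\<close>, then \<open>g\<close> would run from
    \<open>x\<close> to \<open>y\<close>, against the arrow \<open>f\<close> from \<open>y\<close>
    to \<open>x\<close>.\<close>
  then have zx: "z \<noteq> x"
    using no_return[of x y] by auto
  have "bij_betw (Comp C (Comp C f g)) (hom C w z) (hom C w x)"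
    if w: "w \<in> Ob C" "w \<noteq> x" "w \<noteq> y" for w
  proof -
    have "bij_betw (Comp C f \<circ> Comp C g) (hom C w z) (hom C w x)"
      using f g w by (auto simp: down_beat_arrow_def intro!: bij_betw_trans)
    moreover have "(Comp C f \<circ> Comp C g) h = Comp C (Comp C f g) h" if "h \<in> hom C w z" for h
      using Comp_assoc[OF that] * by simp
    ultimately show ?thesis
      by (rule bij_betw_eq)
  qed
  then show ?thesis
    using * zx Comp_in by (auto simp: down_beat_arrow_def)
qed

lemma down_beat_delete_down_beat:
  assumes C: "acyclic_category C" and "down_beat C x" "down_beat C y" "x \<noteq> y"
  shows "down_beat (delete_object C y) x"
proof -
  obtain f x' g y' where "down_beat_arrow C f x' x" "down_beat_arrow C g y' y"
    using assms by (auto simp: down_beat_iff_arrow)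
  then have "\<exists>f x'. down_beat_arrow (delete_object C y) f x' x"
    using down_beat_arrow_delete_other[of C f x' x y] down_beat_arrow_delete_source[OF C, of f y x g y'] assms(4)
    by blast
  then show ?thesis
    using down_beat_iff_arrow[OF acyclic_category_delete_object[OF C]] by blast
qed

text \<open>Every arrow into \<open>x\<close> from another object factors uniquely through
  \<open>f\<close>, and so does every arrow out of \<open>y\<close> to another object. Hence
  \<open>y\<close> can take over the place of \<open>x\<close>, and the isomorphism sends
  \<open>x\<close> to \<open>y\<close> and fixes all other objects.\<close>

lemma isomorphic_delete_ends:
  assumes "acyclic_category C" and down: "down_beat_arrow C f y x"
    and up: "down_beat_arrow (opposite C) f x y"
  shows "isomorphic_categories (delete_object C y) (delete_object C x)"
proof -
  interpret acyclic_category C by fact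
  let ?D = "delete_object C y" and ?E = "delete_object C x"
  have x: "x \<in> Ob C" and y: "y \<in> Ob C" and yx: "y \<noteq> x" and f: "f \<in> hom C y x"
    using down by (auto simp: down_beat_arrow_def)
  \<comment> \<open>\<open>t\<close> is the object part. The arrows \<open>e z\<close> from
    \<open>t z\<close> to \<open>z\<close> are to become the components of a natural transformation;
    the only one that is not an identity is \<open>f\<close>, at \<open>x\<close>.\<close>
  define t where "t z = (if z = x then y else z)" for z
  define e where "e z = (if z = x then f else Id C z)" for z
  have t: "t z \<in> Ob C" "t z \<noteq> x" if "z \<in> Ob C" for z
    using that y yx by (auto simp: t_def)
  have e: "e z \<in> hom C (t z) z" if "z \<in> Ob C" for z
    using that f Id_in by (auto simp: e_def t_def)
  \<comment> \<open>At \<open>w = x\<close> this is the down beat property of \<open>x\<close>;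
    \<open>pre\<close> below is, at \<open>z = x\<close>, the up beat property of
    \<open>y\<close>.\<close>
  have post: "bij_betw (Comp C (e w)) (hom C z (t w)) (hom C z w)"
    if "z \<in> Ob C" "z \<noteq> x" "w \<in> Ob C" for z w
  proof (cases "w = x")
    case True
    then show ?thesis using down that by (simp add: down_beat_arrow_def e_def t_def)
  next
    case False
    then have "bij_betw id (hom C z (t w)) (hom C z w)" by (simp add: t_def)
    moreover have "id h = Comp C (e w) h" if "h \<in> hom C z (t w)" for h
      using that False Comp_Id_left by (simp add: e_def t_def)
    ultimately show ?thesis by (rule bij_betw_eq)
  qed
  have pre: "bij_betw (\<lambda>m. Comp C m (e z)) (hom C z w) (hom C (t z) w)"
    if "z \<in> Ob C" "w \<in> Ob C" "w \<noteq> y" for z w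
  proof (cases "z = x")
    case True
    have "bij_betw (Comp (opposite C) f) (hom C x w) (hom C y w)"
      using up that by (simp add: down_beat_arrow_def)
    moreover have "Comp (opposite C) f = (\<lambda>m. Comp C m f)"
      by (rule ext) simp
    ultimately show ?thesis using True by (simp add: e_def t_def)
  next
    case False
    then have "bij_betw id (hom C z w) (hom C (t z) w)" by (simp add: t_def)
    moreover have "id h = Comp C h (e z)" if "h \<in> hom C z w" for h
      using that False Comp_Id_right by (simp add: e_def)
    ultimately show ?thesis by (rule bij_betw_eq)
  qed
  \<comment> \<open>The arrow part of the isomorphism is determined by making \<open>e\<close> a natural transformation.\<close>
  define F where "F m = inv_into (hom C (t (Dom C m)) (t (Cod C m))) (Comp C (e (Cod C m)))
    (Comp C m (e (Dom C m)))" for m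
  have F_bij: "bij_betw F (hom C z w) (hom C (t z) (t w))"
    if zw: "z \<in> Ob C" "w \<in> Ob C" "w \<noteq> y" for z w
  proof -
    have "bij_betw (inv_into (hom C (t z) (t w)) (Comp C (e w)) \<circ> (\<lambda>m. Comp C m (e z)))
        (hom C z w) (hom C (t z) (t w))"
      using bij_betw_trans[OF pre bij_betw_inv_into[OF post]] zw t by simp
    moreover have "(inv_into (hom C (t z) (t w)) (Comp C (e w)) \<circ> (\<lambda>m. Comp C m (e z))) m = F m"
      if "m \<in> hom C z w" for m
      using that by (simp add: F_def hom_def)
    ultimately show ?thesis by (rule bij_betw_eq)
  qed
  have F_nat: "Comp C (e w) (F m) = Comp C m (e z)"
    if m: "m \<in> hom C z w" "w \<noteq> y" for m z w
  proof -
    have zw: "z \<in> Ob C" "w \<in> Ob C" using hom_Ob[OF m(1)] by auto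
    have "Comp C m (e z) \<in> hom C (t z) w" using Comp_in e zw m by blast
    moreover have "Dom C m = z" "Cod C m = w" using m by (auto simp: hom_def)
    ultimately show ?thesis
      using bij_betw_inv_into_right[OF post] zw t by (simp add: F_def)
  qed
  have F_in: "F m \<in> hom C (t z) (t w)" if "m \<in> hom C z w" "w \<noteq> y" for m z w
    using F_bij hom_Ob that by (meson bij_betwE)
  \<comment> \<open>Postcomposition with \<open>e w\<close> is injective, so an arrow satisfying the
    naturality square must be \<open>F m\<close>. This reduces preservation of identities and
    composites to checking squares.\<close>
  have F_unique: "F m = k"
    if "m \<in> hom C z w" "w \<noteq> y" "k \<in> hom C (t z) (t w)" "Comp C (e w) k = Comp C m (e z)"
    for m k z w
  proof -
    have zw: "z \<in> Ob C" "w \<in> Ob C" using hom_Ob[OF that(1)] by auto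
    then have "inj_on (Comp C (e w)) (hom C (t z) (t w))"
      using post t by (simp add: bij_betw_def)
    then show ?thesis
      using F_nat F_in that by (metis inj_onD)
  qed
  interpret D: category ?D by (rule category_delete_object) unfold_locales
  interpret E: category ?E by (rule category_delete_object) unfold_locales
  have hom_D: "m \<in> hom ?D z w \<longleftrightarrow> m \<in> hom C z w \<and> z \<noteq> y \<and> w \<noteq> y" for m z w
    using hom_Ob by (auto simp: delete_object_def hom_full_subcategory)
  have "iso_functor ?D ?E t F"
  proof
    show "bij_betw t (Ob ?D) (Ob ?E)"
      by (rule bij_betw_byWitness[where f' = "\<lambda>z. if z = y then x else z"])
        (use x y yx in \<open>auto simp: t_def\<close>)
  next
    fix z w assume "z \<in> Ob ?D" "w \<in> Ob ?D"
    then show "bij_betw F (hom ?D z w) (hom ?E (t z) (t w))"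
      using F_bij t by simp
  next
    fix z assume "z \<in> Ob ?D"
    then show "t z \<in> Ob ?E" using t by simp
  next
    fix m z w assume "m \<in> hom ?D z w"
    then show "F m \<in> hom ?E (t z) (t w)"
      using F_in[of m z w] hom_Ob[of m z w] t by (simp add: hom_D)
  next
    fix z assume z: "z \<in> Ob ?D"
    then have "F (Id C z) = Id C (t z)"
      using Id_in t e[of z] by (intro F_unique[of _ z z]) (simp_all add: Comp_Id_left Comp_Id_right)
    then show "F (Id ?D z) = Id ?E (t z)" by simp
  next
    fix m n z w v assume mn: "m \<in> hom ?D z w" "n \<in> hom ?D w v"
    then have m: "m \<in> hom C z w" "w \<noteq> y" and n: "n \<in> hom C w v" "v \<noteq> y"
      by (auto simp: hom_D)
    have ob: "z \<in> Ob C" "w \<in> Ob C" "v \<in> Ob C" using hom_Ob[OF m(1)] hom_Ob[OF n(1)] by auto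
    note ez = e[OF ob(1)] and ew = e[OF ob(2)] and ev = e[OF ob(3)]
    \<comment> \<open>Pasting the naturality squares of \<open>m\<close> and \<open>n\<close> gives
      the square of their composite.\<close>
    have "Comp C (e v) (Comp C (F n) (F m)) = Comp C (Comp C (e v) (F n)) (F m)"
      using Comp_assoc[OF F_in[OF m] F_in[OF n] ev] .
    also have "\<dots> = Comp C (Comp C n (e w)) (F m)" using F_nat[OF n] by simp
    also have "\<dots> = Comp C n (Comp C (e w) (F m))" using Comp_assoc[OF F_in[OF m] ew n(1)] by simp
    also have "\<dots> = Comp C n (Comp C m (e z))" using F_nat[OF m] by simp
    also have "\<dots> = Comp C (Comp C n m) (e z)" using Comp_assoc[OF ez m(1) n(1)] .
    finally have "F (Comp C n m) = Comp C (F n) (F m)"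
      using Comp_in[OF m(1) n(1)] Comp_in[OF F_in[OF m] F_in[OF n]] n(2) by (intro F_unique)
    then show "F (Comp ?D n m) = Comp ?E (F n) (F m)" by simp
  qed
  then show ?thesis by (rule iso_functor.isomorphic)
qed

text \<open>Since \<open>y\<close> is up beat, \<open>f\<close> factors as \<open>k\<close> after
  \<open>g\<close>. If \<open>z\<close> were not \<open>x\<close>, then \<open>k\<close> would
  factor through \<open>f\<close>, giving an arrow from \<open>z\<close> to \<open>y\<close> against
  \<open>g\<close>. So \<open>z = x\<close>, and the endomorphism \<open>k\<close> is an
  identity.\<close>

lemma down_beat_source_up_beat:
  assumes "acyclic_category C" and f: "down_beat_arrow C f y x"
    and g: "down_beat_arrow (opposite C) g z y"
  shows "z = x \<and> g = f"
proof -
  interpret acyclic_category C by fact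
  have *: "x \<in> Ob C" "y \<in> Ob C" "z \<in> Ob C" "y \<noteq> x" "z \<noteq> y" "f \<in> hom C y x" "g \<in> hom C y z"
    using f g by (auto simp: down_beat_arrow_def)
  have "bij_betw (Comp (opposite C) g) (hom C z x) (hom C y x)"
    using g * by (auto simp: down_beat_arrow_def)
  then obtain k where k: "k \<in> hom C z x" "f = Comp C k g"
    using *(6) by (auto simp: bij_betw_def)
  have "z = x"
  proof (rule ccontr)
    assume "z \<noteq> x"
    then have "bij_betw (Comp C f) (hom C z y) (hom C z x)"
      using f * by (auto simp: down_beat_arrow_def)
    then have "hom C z y \<noteq> {}"
      using k(1) by (auto simp: bij_betw_def)
    then show False using no_return[of y z] * by auto
  qed
  then show ?thesis
    using k endo_Id[of x k] Comp_Id_left *(1,7) by auto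
qed

text \<open>Unless the arrow into \<open>x\<close> starts at \<open>y\<close> or the arrow out of
  \<open>y\<close> ends at \<open>x\<close>, both arrows survive the other deletion. Otherwise they
  are the same arrow from \<open>y\<close> to \<open>x\<close>, and
  \<open>isomorphic_delete_ends\<close> applies. The case \<open>x = y\<close>, an object both down
  and up beat, is trivial.\<close>

lemma beat_objects_confluent_down_up:
  assumes C: "acyclic_category C" and "down_beat C x" "up_beat C y"
  shows "down_beat (delete_object C y) x \<and> up_beat (delete_object C x) y \<or>
    isomorphic_categories (delete_object C x) (delete_object C y)"
proof -
  obtain f x' g y' where f: "down_beat_arrow C f x' x" and g: "down_beat_arrow (opposite C) g y' y"
    using assms(2,3) unfolding down_beat_iff_arrow[OF C] up_beat_iff_arrow[OF C] by blast
  consider "x = y" | "x' = y" | "y' = x" | "x \<noteq> y" "x' \<noteq> y" "y' \<noteq> x" by blast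
  then show ?thesis
  proof cases
    case 1
    have "category (delete_object C x)"
      using C by (simp add: acyclic_category_def category_delete_object)
    then show ?thesis using isomorphic_categories_refl[of "delete_object C x"] 1 by simp
  next
    case 2
    then have "y' = x \<and> g = f" using down_beat_source_up_beat[OF C, of f y x g y'] f g by simp
    then show ?thesis
      using isomorphic_categories_sym[OF isomorphic_delete_ends[OF C]] f g 2 by simp
  next
    case 3
    \<comment> \<open>The same lemma in the opposite category, where \<open>x\<close> and
      \<open>y\<close> exchange roles, as do \<open>f\<close> and \<open>g\<close>.\<close>
    then have "x' = y \<and> f = g"
      using down_beat_source_up_beat[OF acyclic_category_opposite[OF C], of g x y f x'] f g by simp
    then show ?thesis
      using isomorphic_categories_sym[OF isomorphic_delete_ends[OF C]] f g 3 by simp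
  next
    case 4
    then show ?thesis
      using down_beat_arrow_delete_other[OF f, of y] down_beat_arrow_delete_other[OF g, of x]
      unfolding down_beat_iff_arrow[OF acyclic_category_delete_object[OF C]]
        up_beat_iff_arrow[OF acyclic_category_delete_object[OF C]] opposite_delete_object
      by blast
  qed
qed

text \<open>Two down beat objects never obstruct each other, and by duality neither do two up beat
  objects; the mixed cases are the previous lemma.\<close>

lemma beat_objects_confluent:
  assumes C: "acyclic_category C" and x: "beat_object C x" and y: "beat_object C y" and "x \<noteq> y"
  shows "beat_object (delete_object C y) x \<and> beat_object (delete_object C x) y \<or>
    isomorphic_categories (delete_object C x) (delete_object C y)"
  using x y down_beat_delete_down_beat[OF C]
    down_beat_delete_down_beat[OF acyclic_category_opposite[OF C]]
    beat_objects_confluent_down_up[OF C, of x y] beat_objects_confluent_down_up[OF C, of y x]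
    isomorphic_categories_sym[of "delete_object C y" "delete_object C x"] \<open>x \<noteq> y\<close>
  unfolding beat_object_def up_beat_def opposite_delete_object by metis

section \<open>Cores\<close>

lemma elementary_strong_collapse_acyclic:
  "elementary_strong_collapse C D \<Longrightarrow> acyclic_category C \<Longrightarrow> acyclic_category D"
  by (auto simp: elementary_strong_collapse_def acyclic_category_delete_object)

lemma strong_collapse_acyclic:
  "strong_collapse C D \<Longrightarrow> acyclic_category C \<Longrightarrow> acyclic_category D"
  unfolding strong_collapse_def
  by (induction rule: rtranclp_induct) (auto intro: elementary_strong_collapse_acyclic)

lemma strong_collapse_step:
  assumes "beat_object C x" and "strong_collapse (delete_object C x) D"
  shows "strong_collapse C D"
  using assms unfolding strong_collapse_def
  by (intro converse_rtranclp_into_rtranclp[of elementary_strong_collapse C "delete_object C x" D])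
    (auto simp: elementary_strong_collapse_def)

lemma strong_collapse_cases:
  assumes "strong_collapse C D"
  obtains "D = C" | x where "beat_object C x" "strong_collapse (delete_object C x) D"
  using assms unfolding strong_collapse_def
  by (cases rule: converse_rtranclpE) (auto simp: elementary_strong_collapse_def)

lemma strong_collapse_minimal_exists:
  assumes "acyclic_category C" "finite (Ob C)"
  shows "\<exists>D. strong_collapse C D \<and> minimal_category D"
  using assms
proof (induction "card (Ob C)" arbitrary: C rule: less_induct)
  case less
  show ?case
  proof (cases "\<exists>x. beat_object C x")
    case True
    then obtain x where x: "beat_object C x" by blast
    then have "card (Ob (delete_object C x)) < card (Ob C)"
      using card_Diff1_less[OF less.prems(2) beat_object_Ob[OF x]] by simp
    then obtain D where "strong_collapse (delete_object C x) D" "minimal_category D"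
      using less.hyps[of "delete_object C x"] less.prems acyclic_category_delete_object[of C x]
      by auto
    then show ?thesis
      using strong_collapse_step[OF x] by auto
  next
    case False
    then show ?thesis
      using less.prems by (auto simp: minimal_category_def strong_collapse_def)
  qed
qed

text \<open>Each deletion of \<open>x\<close> is mirrored by deleting its image, which is again a
  beat object; the isomorphism restricts to the remaining objects.\<close>

lemma strong_collapse_iso:
  assumes "strong_collapse C B" "isomorphic_categories C D" "acyclic_category C" "acyclic_category D"
  shows "\<exists>B'. strong_collapse D B' \<and> isomorphic_categories B B'"
  using assms(1) unfolding strong_collapse_def
proof (induction rule: rtranclp_induct)
  case base
  then show ?case using assms(2) by blast
next
  case (step M N)
  then obtain B' where B': "elementary_strong_collapse\<^sup>*\<^sup>* D B'" "isomorphic_categories M B'" by blast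
  obtain x where x: "beat_object M x" "N = delete_object M x"
    using step by (auto simp: elementary_strong_collapse_def)
  obtain Fo Fa where F: "iso_functor M B' Fo Fa"
    using isomorphic_categories_iso_functor[OF B'(2)] .
  have "acyclic_category M" "acyclic_category B'"
    using strong_collapse_acyclic assms(3,4) step.hyps(1) B'(1) by (auto simp: strong_collapse_def)
  then have "beat_object B' (Fo x)"
    using beat_object_iso[OF F] x by blast
  then have "elementary_strong_collapse\<^sup>*\<^sup>* D (delete_object B' (Fo x))"
    using B'(1) by (metis elementary_strong_collapse_def rtranclp.rtrancl_into_rtrancl)
  moreover have "isomorphic_categories N (delete_object B' (Fo x))"
    using iso_functor.isomorphic[OF iso_functor_delete_object[OF F beat_object_Ob[OF x(1)]]] x(2)
    by simp
  ultimately show ?case by blast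
qed

lemma minimal_category_iso:
  assumes "minimal_category B" "isomorphic_categories B B'" "acyclic_category B'"
  shows "minimal_category B'"
proof -
  obtain Fo Fa where F: "iso_functor B' B Fo Fa"
    using isomorphic_categories_iso_functor[OF isomorphic_categories_sym[OF assms(2)]] .
  have "beat_object B (Fo x)" if "beat_object B' x" for x
    using beat_object_iso[OF F assms(3) _ that] assms(1) by (simp add: minimal_category_def)
  then show ?thesis
    using assms(1,3) by (auto simp: minimal_category_def)
qed

text \<open>Strong induction on the number of objects, comparing the first deletions
  \<open>x\<close> and \<open>y\<close> of the two collapses. The hypothesis applies to minimal
  categories reached after the same first deletion, so a category linking the two branches is
  needed.\<close>

lemma strong_collapse_minimal_unique:
  assumes "acyclic_category C" "finite (Ob C)" "strong_collapse C B" "strong_collapse C B'"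
    "minimal_category B" "minimal_category B'"
  shows "isomorphic_categories B B'"
  using assms
proof (induction "card (Ob C)" arbitrary: C B B' rule: less_induct)
  case less
  note C = less.prems(1)
  have minimal: "E = C" if "strong_collapse C E" "\<nexists>x. beat_object C x" for E
    using that(1) by (rule strong_collapse_cases) (use that(2) in auto)
  have first: "\<exists>x. beat_object C x \<and> strong_collapse (delete_object C x) E"
    if "strong_collapse C E" "minimal_category E" "\<exists>x. beat_object C x" for E
    using that(1) by (rule strong_collapse_cases) (use that in \<open>auto simp: minimal_category_def\<close>)
  have IH: "isomorphic_categories E E'"
    if "beat_object C x" "strong_collapse (delete_object C x) E"
      "strong_collapse (delete_object C x) E'" "minimal_category E" "minimal_category E'" for x E E'
    using that less.hyps[of "delete_object C x" E E'] less.prems(2)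
      card_Diff1_less[OF less.prems(2) beat_object_Ob[OF that(1)]] acyclic_category_delete_object[OF C]
    by simp
  show ?case
  proof (cases "\<exists>x. beat_object C x")
    case False
    then have "B = C" "B' = C"
      using minimal less.prems(3,4) by auto
    then show ?thesis
      using isomorphic_categories_refl[of C] C by (simp add: acyclic_category_def)
  next
    case True
    obtain x where x: "beat_object C x" "strong_collapse (delete_object C x) B"
      using first[OF less.prems(3,5) True] by auto
    obtain y where y: "beat_object C y" "strong_collapse (delete_object C y) B'"
      using first[OF less.prems(4,6) True] by auto
    consider "x = y"
      | "x \<noteq> y" "beat_object (delete_object C y) x" "beat_object (delete_object C x) y"
      | "isomorphic_categories (delete_object C x) (delete_object C y)"
      using beat_objects_confluent[OF C x(1) y(1)] by blast
    then show ?thesis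
    proof cases
      case 1
      then show ?thesis using IH[OF y(1) _ y(2) less.prems(5,6)] x(2) by simp
    next
      case 2
      \<comment> \<open>Any minimal \<open>M\<close> reached from the common corner
        \<open>?E\<close> is reachable from both branches, so \<open>B\<close> and \<open>B'\<close>
        are each isomorphic to \<open>M\<close>.\<close>
      let ?E = "delete_object (delete_object C x) y"
      obtain M where M: "strong_collapse ?E M" "minimal_category M"
        using strong_collapse_minimal_exists[of ?E] less.prems(2)
          acyclic_category_delete_object[OF acyclic_category_delete_object[OF C]] by auto
      have "strong_collapse (delete_object C x) M"
        using strong_collapse_step[OF 2(3) M(1)] .
      moreover have "strong_collapse (delete_object C y) M"
        using strong_collapse_step[OF 2(2)] M(1) delete_object_commute[of C x y] by simp
      ultimately show ?thesis
        using IH[OF x _ less.prems(5) M(2)] IH[OF y(1) _ y(2) M(2) less.prems(6)]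
          isomorphic_categories_trans[of B M B'] by simp
    next
      case 3
      \<comment> \<open>The collapse to \<open>B\<close> is copied into the branch of
        \<open>y\<close>, where its end \<open>B''\<close> can be compared with
        \<open>B'\<close>.\<close>
      obtain B'' where B'': "strong_collapse (delete_object C y) B''" "isomorphic_categories B B''"
        using strong_collapse_iso[OF x(2) 3 acyclic_category_delete_object[OF C]
            acyclic_category_delete_object[OF C]] by auto
      have "acyclic_category B''"
        using strong_collapse_acyclic[OF B''(1) acyclic_category_delete_object[OF C]] .
      then have "minimal_category B''"
        using minimal_category_iso[OF less.prems(5) B''(2)] by simp
      then show ?thesis
        using IH[OF y(1) B''(1) y(2) _ less.prems(6)] isomorphic_categories_trans[OF B''(2)] by simp
    qed
  qed
qed

theorem corollary2p13:
  fixes A B B' :: "('o, 'm) cat_data"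
  assumes "acyclic_category A" and "finite_category A"
    and "is_core A B" and "is_core A B'"
  shows "isomorphic_categories B B'"
  using assms strong_collapse_minimal_unique[of A B B']
  by (simp add: finite_category_def is_core_def)

end
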